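(* Suppose there is a function $\theta:\mathbb{R}_{++}\to\mathbb{R}_{++}$ such that for all $s_1,s_2>0$, all $c^*\in G$ and all $x\in\mathrm{int}(\Omega)$, $$D_\omega\big(x,\nabla\omega^*(\nabla\omega(x)-s_1JF(x)^Tc^* )\big)\ge\theta\Big(\frac{s_1}{s_2}\Big)D_\omega\big(x,\nabla\omega^*(\nabla\omega(x)-s_2JF(x)^Tc^* )\big).$$ Let $x\in\mathrm{int}(\Omega)$ and $\ell_1\ge\ell_2>0$. Then $$v_{\ell_1}(x)\le v_{\ell_2}(x)\le\frac{\ell_2}{\theta\big(\frac{\ell_2}{\ell_1}\big)\ell_1}v_{\ell_1}(x).$$
   Context: $C\subset\mathbb{R}^m$ is a closed, convex, pointed cone with nonempty interior. $C^*=\{c^*\in\mathbb{R}^m:\langle c^*,c\rangle\ge 0\ \forall c\in C\}$ and $G=\mathrm{conv}(\{c^*\in C^*:\|c^*\|=1\})$. $\Omega\subset\mathbb{R}^n$ is closed and convex with nonempty interior, $F:\mathbb{R}^n\to\mathbb{R}^m$ is differentiable with Jacobian $JF(x)\in\mathbb{R}^{m\times n}$. $\mathbb{R}_{++}=(0,\infty)$. Legendre function: a proper closed convex function $\omega$ on $\mathbb{R}^n$ with values in $(-\infty,+\infty]$ that is essentially smooth (differentiable on $\mathrm{int}(\mathrm{dom}\,\omega)$, with $\|\nabla\omega(x^k)\|\to\infty$ for every sequence $\{x^k\}\subset\mathrm{int}(\mathrm{dom}\,\omega)$ converging to a boundary point of $\mathrm{dom}\,\omega$) and strictly convex on $\mathrm{int}(\mathrm{dom}\,\omega)$.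 Here $\omega$ is a Legendre function with $\mathrm{cl}(\mathrm{dom}\,\omega)=\Omega$ (so $\mathrm{int}(\mathrm{dom}\,\omega)=\mathrm{int}(\Omega)$); $\omega^*(x^* )=\sup_{x}\{\langle x^*,x\rangle-\omega(x)\}$ is its conjugate. Bregman distance: $D_\omega(x,y)=\omega(x)-\omega(y)-\langle\nabla\omega(y),x-y\rangle$ for $y\in\mathrm{int}(\mathrm{dom}\,\omega)$ (equal to $+\infty$ when $\omega(x)=+\infty$). The hypothesis with $\theta$ includes that the expressions in it are defined, i.e. $\nabla\omega(x)-sJF(x)^Tc^*\in\mathrm{int}(\mathrm{dom}\,\omega^* )$ for all $s>0$, $c^*\in G$, $x\in\mathrm{int}(\Omega)$ (automatic when $\omega$ is supercoercive). For $\ell>0$: $v_\ell(x)=\sup_{y\in\Omega}\min_{c^*\in G}\{\langle c^*,JF(x)(x-y)\rangle-\ell D_\omega(y,x)\}$. Standing assumption: for each $\ell>0$ and $x\in\mathrm{int}(\Omega)$ the maximizer $V_\ell(x)$ in this supremum exists, is unique, and lies in $\mathrm{int}(\Omega)$. *)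

theory Defs
  imports "HOL-Analysis.Analysis"
begin

section \<open>Cones\<close>

definition pointed :: "'a::real_vector set \<Rightarrow> bool"
  where "pointed C \<longleftrightarrow> C \<inter> uminus ` C = {0}"

definition dual_cone :: "'a::real_inner set \<Rightarrow> 'a set"
  where "dual_cone C = {d. \<forall>c\<in>C. 0 \<le> d \<bullet> c}"

definition dual_generator :: "'a::real_inner set \<Rightarrow> 'a set"
  where "dual_generator C = convex hull {d \<in> dual_cone C. norm d = 1}"


section \<open>Extended-valued convex functions\<close>

definition edom :: "('a \<Rightarrow> ereal) \<Rightarrow> 'a set"
  where "edom f = {x. f x < \<infinity>}"

definition eepigraph :: "('a \<Rightarrow> ereal) \<Rightarrow> ('a \<times> real) set"
  where "eepigraph f = {(x, r). f x \<le> ereal r}"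

definition proper :: "('a \<Rightarrow> ereal) \<Rightarrow> bool"
  where "proper f \<longleftrightarrow> (\<forall>x. f x \<noteq> -\<infinity>) \<and> (\<exists>x. f x < \<infinity>)"

definition closed_convex_fun :: "('a::real_normed_vector \<Rightarrow> ereal) \<Rightarrow> bool"
  where "closed_convex_fun f \<longleftrightarrow> convex (eepigraph f) \<and> closed (eepigraph f)"

text \<open>Differentiability and gradients are only used at points of the interior of
  the effective domain, near which a proper function agrees with its real-valued version.\<close>

definition ediff_at :: "('a::real_normed_vector \<Rightarrow> ereal) \<Rightarrow> 'a \<Rightarrow> bool"
  where "ediff_at f x \<longleftrightarrow> (\<lambda>u. real_of_ereal (f u)) differentiable (at x)"

definition egrad :: "('a::real_inner \<Rightarrow> ereal) \<Rightarrow> 'a \<Rightarrow> 'a"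
  where "egrad f x = (THE g. GDERIV (\<lambda>u. real_of_ereal (f u)) x :> g)"

definition essentially_smooth :: "('a::real_inner \<Rightarrow> ereal) \<Rightarrow> bool"
  where "essentially_smooth f \<longleftrightarrow>
    (\<forall>x\<in>interior (edom f). ediff_at f x) \<and>
    (\<forall>X x. (\<forall>k. X k \<in> interior (edom f)) \<and> X \<longlonglongrightarrow> x \<and> x \<in> frontier (edom f) \<longrightarrow>
       filterlim (\<lambda>k. norm (egrad f (X k))) at_top sequentially)"

definition strictly_convex_on :: "'a::real_vector set \<Rightarrow> ('a \<Rightarrow> ereal) \<Rightarrow> bool"
  where "strictly_convex_on S f \<longleftrightarrow> convex S \<and>
    (\<forall>x\<in>S. \<forall>y\<in>S. \<forall>t::real. x \<noteq> y \<and> 0 < t \<and> t < 1 \<longrightarrow>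
       f ((1 - t) *\<^sub>R x + t *\<^sub>R y) < ereal (1 - t) * f x + ereal t * f y)"

definition legendre :: "('a::real_inner \<Rightarrow> ereal) \<Rightarrow> bool"
  where "legendre f \<longleftrightarrow> proper f \<and> closed_convex_fun f \<and>
    essentially_smooth f \<and> strictly_convex_on (interior (edom f)) f"

definition conjugate :: "('a::real_inner \<Rightarrow> ereal) \<Rightarrow> 'a \<Rightarrow> ereal"
  where "conjugate f z = (SUP x. ereal (z \<bullet> x) - f x)"

text \<open>Intended for \<open>y\<close> in the interior of the effective domain of \<open>w\<close>, so that \<open>w y\<close>
  is finite; then \<open>bregman w x y = \<infinity>\<close> whenever \<open>w x = \<infinity>\<close>.\<close>

definition bregman :: "('a::real_inner \<Rightarrow> ereal) \<Rightarrow> 'a \<Rightarrow> 'a \<Rightarrow> ereal"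
  where "bregman w x y = w x - w y - ereal (egrad w y \<bullet> (x - y))"


section \<open>The regularized gap function\<close>

text \<open>The infimum in \<open>gap_obj\<close> is a minimum, see \<open>gap_obj_attained\<close> below. It equals
  \<open>-\<infinity>\<close> at points \<open>y\<close> with \<open>w y = \<infinity>\<close>.\<close>

definition gap_obj ::
    "(real^'m) set \<Rightarrow> (real^'n \<Rightarrow> real^'m) \<Rightarrow> (real^'n \<Rightarrow> ereal) \<Rightarrow> real \<Rightarrow> real^'n \<Rightarrow> real^'n \<Rightarrow> ereal"
  where "gap_obj C F w l x y =
    (INF d\<in>dual_generator C.
       ereal (d \<bullet> (jacobian F (at x) *v (x - y))) - ereal l * bregman w y x)"

definition gap ::
    "(real^'m) set \<Rightarrow> (real^'n) set \<Rightarrow> (real^'n \<Rightarrow> real^'m) \<Rightarrow> (real^'n \<Rightarrow> ereal) \<Rightarrow> real \<Rightarrow> real^'n \<Rightarrow> ereal"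
  where "gap C \<Omega> F w l x = (SUP y\<in>\<Omega>. gap_obj C F w l x y)"

definition gap_maximizer ::
    "(real^'m) set \<Rightarrow> (real^'n) set \<Rightarrow> (real^'n \<Rightarrow> real^'m) \<Rightarrow> (real^'n \<Rightarrow> ereal) \<Rightarrow> real \<Rightarrow> real^'n \<Rightarrow> real^'n"
  where "gap_maximizer C \<Omega> F w l x = arg_max_on (gap_obj C F w l x) \<Omega>"

lemma compact_dual_generator:
  fixes C :: "'a::euclidean_space set"
  shows "compact (dual_generator C)"
proof -
  have "dual_cone C = (\<Inter>c\<in>C. {d. 0 \<le> d \<bullet> c})"
    by (auto simp: dual_cone_def)
  moreover have "closed {d. 0 \<le> d \<bullet> c}" for c :: 'a
    by (intro closed_Collect_le continuous_intros)
  ultimately have "closed (dual_cone C)" by auto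
  moreover have "{d \<in> dual_cone C. norm d = 1} = sphere 0 1 \<inter> dual_cone C"
    by auto
  ultimately have "compact {d \<in> dual_cone C. norm d = 1}"
    by (metis compact_Int_closed compact_sphere)
  then show ?thesis
    unfolding dual_generator_def by (rule compact_convex_hull)
qed

lemma dual_generator_nonempty:
  fixes C :: "'a::euclidean_space set"
  assumes "closed C" "convex C" "cone C" "pointed C"
  shows "dual_generator C \<noteq> {}"
proof -
  have "C \<noteq> UNIV"
  proof
    assume C: "C = UNIV"
    have "surj (uminus :: 'a \<Rightarrow> 'a)" by (metis minus_minus surj_def)
    then have U: "(UNIV :: 'a set) = {0}" using assms(4) C by (simp add: pointed_def)
    obtain b :: 'a where "b \<in> Basis" using nonempty_Basis by blast
    moreover have "b = 0" using U by blast
    ultimately show False by simp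
  qed
  then obtain z where "z \<notin> C" by blast
  then obtain a b where ab: "a \<bullet> z < b" "\<forall>y\<in>C. b < a \<bullet> y"
    using separating_hyperplane_closed_point[OF assms(2,1)] by blast
  have "0 \<in> C" using assms(4) by (auto simp: pointed_def)
  then have "b < 0" using ab(2) by fastforce
  have a: "0 \<le> a \<bullet> y" if "y \<in> C" for y
  proof (rule ccontr)
    assume "\<not> 0 \<le> a \<bullet> y"
    then have neg: "a \<bullet> y < 0" by simp
    have "(b / (a \<bullet> y)) *\<^sub>R y \<in> C"
      using assms(3) that neg \<open>b < 0\<close> unfolding cone_def
      by (simp add: divide_nonpos_neg)
    then have "b < a \<bullet> ((b / (a \<bullet> y)) *\<^sub>R y)" using ab(2) by blast
    then show False using neg by simp
  qed
  have "a \<noteq> 0" using ab(1) \<open>b < 0\<close> by auto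
  then have "(1 / norm a) *\<^sub>R a \<in> {d \<in> dual_cone C. norm d = 1}"
    using a by (auto simp: dual_cone_def)
  then show ?thesis unfolding dual_generator_def by (metis convex_hull_eq_empty empty_iff)
qed

lemma gap_obj_attained:
  assumes "closed C" "convex C" "cone C" "pointed C"
  shows "\<exists>d\<in>dual_generator C. gap_obj C F w l x y =
    ereal (d \<bullet> (jacobian F (at x) *v (x - y))) - ereal l * bregman w y x"
proof -
  let ?u = "jacobian F (at x) *v (x - y)"
  have "continuous_on (dual_generator C) (\<lambda>d. d \<bullet> ?u)"
    by (intro continuous_intros)
  then obtain d where d: "d \<in> dual_generator C"
    "\<forall>e\<in>dual_generator C. d \<bullet> ?u \<le> e \<bullet> ?u"
    using continuous_attains_inf[OF compact_dual_generator dual_generator_nonempty[OF assms]]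
    by blast
  have "gap_obj C F w l x y = ereal (d \<bullet> ?u) - ereal l * bregman w y x"
    unfolding gap_obj_def
    by (rule antisym) (use d in \<open>auto intro!: INF_lower2 INF_greatest ereal_minus_mono\<close>)
  with d(1) show ?thesis by blast
qed

end

theory Submission
  imports Defs
begin

text \<open>Let \<open>y1\<close> be the maximizer for \<open>l1\<close>. Since it is an interior point, first-order optimality and
  a separation argument yield a weight \<open>d\<close> in the dual generator which is minimal at \<open>y1\<close> and satisfies
  \<open>\<nabla>\<omega>(y1) = \<nabla>\<omega>(x) - J\<^sup>T d / l1\<close>. For such a saddle point the gap for \<open>l1\<close> is at least
  \<open>l1 D(x, y1)\<close>. For every \<open>l\<close>, the maximum over \<open>y\<close> of the objective with the weight \<open>d\<close> held fixed
  is \<open>l D(x, \<nabla>\<omega>*(\<nabla>\<omega>(x) - J\<^sup>T d / l))\<close>, which bounds the gap for \<open>l2\<close> from above with the same \<open>d\<close>;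
  the hypothesis on \<open>\<theta>\<close> compares the two distances. That \<open>\<nabla>\<omega>*\<close> inverts \<open>\<nabla>\<omega>\<close> on the interior of
  the domain of \<open>\<omega>*\<close> is the Legendre property of \<open>\<omega>\<close>.\<close>

section \<open>Gradients\<close>

lemma egrad_eqI:
  assumes "GDERIV (\<lambda>u. real_of_ereal (f u)) x :> g"
  shows "egrad f x = g"
  unfolding egrad_def
proof (rule the_equality)
  fix h assume "GDERIV (\<lambda>u. real_of_ereal (f u)) x :> h"
  then have "(\<lambda>k. k \<bullet> h) = (\<lambda>k. k \<bullet> g)"
    using assms unfolding gderiv_def by (rule has_derivative_unique)
  then show "h = g" by (metis inner_eq_zero_iff inner_diff_right right_minus_eq)
qed (fact assms)

text \<open>The derivative \<open>D\<close> is a linear functional and \<open>adjoint D 1\<close> is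
  its Riesz representer, so the description in \<open>egrad\<close> does denote a gradient.\<close>

lemma ediff_at_egrad:
  fixes f :: "'a::euclidean_space \<Rightarrow> ereal"
  assumes "ediff_at f x"
  shows "GDERIV (\<lambda>u. real_of_ereal (f u)) x :> egrad f x"
proof -
  obtain D where D: "((\<lambda>u. real_of_ereal (f u)) has_derivative D) (at x)"
    using assms unfolding ediff_at_def differentiable_def by blast
  then have "linear D" by (rule has_derivative_linear)
  then have "D = (\<lambda>h. h \<bullet> adjoint D 1)"
    using adjoint_works[of D] by (simp add: fun_eq_iff)
  then have "GDERIV (\<lambda>u. real_of_ereal (f u)) x :> adjoint D 1"
    unfolding gderiv_def using D by metis
  then show ?thesis using egrad_eqI by metis
qed

lemma GDERIV_directional:
  assumes "GDERIV F x :> g"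
  shows "((\<lambda>t. (F (x + t *\<^sub>R d) - F x) / t) \<longlongrightarrow> g \<bullet> d) (at_right 0)"
proof -
  have "((\<lambda>t::real. x + t *\<^sub>R d) has_derivative (\<lambda>t. t *\<^sub>R d)) (at 0)"
    by (auto intro!: derivative_eq_intros)
  moreover have "(F has_derivative (\<lambda>h. h \<bullet> g)) (at (x + 0 *\<^sub>R d))"
    using assms by (simp add: gderiv_def)
  ultimately have "((\<lambda>t. F (x + t *\<^sub>R d)) has_derivative (\<lambda>t. (t *\<^sub>R d) \<bullet> g)) (at 0)"
    by (rule has_derivative_compose)
  then have "((\<lambda>t. F (x + t *\<^sub>R d)) has_field_derivative g \<bullet> d) (at 0)"
    by (simp add: has_field_derivative_def inner_commute mult_commute_abs)
  then have "((\<lambda>t. (F (x + t *\<^sub>R d) - F x) / t) \<longlongrightarrow> g \<bullet> d) (at 0)"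
    by (simp add: DERIV_def)
  then show ?thesis by (rule filterlim_at_split[THEN iffD1, THEN conjunct2])
qed

lemma GDERIV_directional_le:
  assumes "GDERIV F x :> g" and "\<And>t. \<lbrakk>0 < t; t < 1\<rbrakk> \<Longrightarrow> F (x + t *\<^sub>R d) \<le> F x + t * m"
  shows "g \<bullet> d \<le> m"
proof (rule tendsto_upperbound[OF GDERIV_directional[OF assms(1)]])
  show "\<forall>\<^sub>F t in at_right 0. (F (x + t *\<^sub>R d) - F x) / t \<le> m"
    unfolding eventually_at_right_field
    by (rule exI[of _ 1]) (use assms(2) in \<open>force simp: divide_le_eq algebra_simps\<close>)
qed simp

text \<open>The bound is asked only for \<open>t < e\<close>, since a segment leaving an interior
  point is sure to stay in the effective domain only for small \<open>t\<close>.\<close>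

lemma GDERIV_directional_ge:
  assumes "GDERIV F x :> g" and "0 < e"
    and "\<And>t. \<lbrakk>0 < t; t < e\<rbrakk> \<Longrightarrow> F x + t * m \<le> F (x + t *\<^sub>R d)"
  shows "m \<le> g \<bullet> d"
proof (rule tendsto_lowerbound[OF GDERIV_directional[OF assms(1)]])
  show "\<forall>\<^sub>F t in at_right 0. m \<le> (F (x + t *\<^sub>R d) - F x) / t"
    unfolding eventually_at_right_field
    by (rule exI[of _ e]) (use assms(2,3) in \<open>force simp: le_divide_eq algebra_simps\<close>)
qed simp


section \<open>Subgradients of Legendre functions\<close>

lemma proper_eq_ereal:
  assumes "proper f" "y \<in> edom f"
  shows "f y = ereal (real_of_ereal (f y))"
  using assms unfolding proper_def edom_def by (cases "f y") auto

lemma convex_fun_combination: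
  assumes "proper f" "convex (eepigraph f)" "x \<in> edom f" "y \<in> edom f" "0 \<le> t" "t \<le> 1"
  shows "(1 - t) *\<^sub>R x + t *\<^sub>R y \<in> edom f"
    and "real_of_ereal (f ((1 - t) *\<^sub>R x + t *\<^sub>R y))
      \<le> (1 - t) * real_of_ereal (f x) + t * real_of_ereal (f y)"
proof -
  have "(x, real_of_ereal (f x)) \<in> eepigraph f" "(y, real_of_ereal (f y)) \<in> eepigraph f"
    using proper_eq_ereal[OF assms(1)] assms(3,4) unfolding eepigraph_def by force+
  from convexD_alt[OF assms(2) this assms(5,6)]
  have le: "f ((1 - t) *\<^sub>R x + t *\<^sub>R y)
      \<le> ereal ((1 - t) * real_of_ereal (f x) + t * real_of_ereal (f y))"
    by (simp add: eepigraph_def)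
  then show dom: "(1 - t) *\<^sub>R x + t *\<^sub>R y \<in> edom f"
    unfolding edom_def by (auto intro: le_less_trans)
  show "real_of_ereal (f ((1 - t) *\<^sub>R x + t *\<^sub>R y))
      \<le> (1 - t) * real_of_ereal (f x) + t * real_of_ereal (f y)"
    using le proper_eq_ereal[OF assms(1) dom] by (metis ereal_less_eq(3))
qed

lemma convex_edom:
  assumes "proper f" "convex (eepigraph f)"
  shows "convex (edom f)"
  unfolding convex_alt using convex_fun_combination(1)[OF assms] by blast

text \<open>For proper \<open>f\<close> the subgradient inequality is trivial where \<open>f\<close>
  is infinite. Restricting \<open>u\<close> to \<open>edom f\<close> avoids the value 0 that
  \<open>real_of_ereal\<close> takes there.\<close>

definition subgradient :: "('a::real_inner \<Rightarrow> ereal) \<Rightarrow> 'a \<Rightarrow> 'a \<Rightarrow> bool"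
  where "subgradient f z y \<longleftrightarrow> y \<in> edom f \<and>
    (\<forall>u\<in>edom f. real_of_ereal (f y) + z \<bullet> (u - y) \<le> real_of_ereal (f u))"

text \<open>By convexity the difference quotients at \<open>y\<close> towards \<open>u\<close> are
  at most the increment of \<open>f\<close> from \<open>y\<close> to \<open>u\<close>, and so is
  their limit.\<close>

lemma subgradient_egrad:
  fixes f :: "'a::euclidean_space \<Rightarrow> ereal"
  assumes "proper f" "convex (eepigraph f)" "y \<in> edom f" "ediff_at f y"
  shows "subgradient f (egrad f y) y"
  unfolding subgradient_def
proof (intro conjI ballI)
  fix u assume u: "u \<in> edom f"
  have "egrad f y \<bullet> (u - y) \<le> real_of_ereal (f u) - real_of_ereal (f y)"
  proof (rule GDERIV_directional_le[OF ediff_at_egrad[OF assms(4)]])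
    fix t :: real assume t: "0 < t" "t < 1"
    have "y + t *\<^sub>R (u - y) = (1 - t) *\<^sub>R y + t *\<^sub>R u" by (simp add: algebra_simps)
    then show "real_of_ereal (f (y + t *\<^sub>R (u - y)))
        \<le> real_of_ereal (f y) + t * (real_of_ereal (f u) - real_of_ereal (f y))"
      using convex_fun_combination(2)[OF assms(1,2,3) u, of t] t by (simp add: algebra_simps)
  qed
  then show "real_of_ereal (f y) + egrad f y \<bullet> (u - y) \<le> real_of_ereal (f u)" by simp
qed (fact assms(3))

lemma interior_add_scaleR:
  fixes y :: "'a::real_normed_vector"
  assumes "y \<in> interior S"
  obtains e where "0 < e" "\<And>t. \<lbrakk>0 < t; t < e\<rbrakk> \<Longrightarrow> y + t *\<^sub>R d \<in> S"
proof -
  obtain r where r: "0 < r" "ball y r \<subseteq> S" using assms mem_interior by blast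
  show thesis
  \<comment> \<open>Adding 1 keeps the denominator positive when \<open>d = 0\<close>.\<close>
  proof (rule that[of "r / (norm d + 1)"])
    show "0 < r / (norm d + 1)" using r(1) by (intro divide_pos_pos) (auto intro: add_nonneg_pos)
    fix t assume t: "0 < t" "t < r / (norm d + 1)"
    have "norm d + 1 > 0" by (rule add_nonneg_pos) auto
    then have "t * norm d < r" using t by (simp add: less_divide_eq algebra_simps)
    then have "y + t *\<^sub>R d \<in> ball y r" using t(1) by (simp add: dist_norm)
    then show "y + t *\<^sub>R d \<in> S" using r(2) by blast
  qed
qed

text \<open>Testing the subgradient inequality in the direction \<open>d = z - egrad f y\<close>
  yields \<open>d \<bullet> d \<le> 0\<close>.\<close>

lemma subgradient_imp_egrad:
  fixes f :: "'a::euclidean_space \<Rightarrow> ereal"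
  assumes "subgradient f z y" "y \<in> interior (edom f)" "ediff_at f y"
  shows "egrad f y = z"
proof -
  define d where "d = z - egrad f y"
  obtain e where e: "0 < e" "\<And>t. \<lbrakk>0 < t; t < e\<rbrakk> \<Longrightarrow> y + t *\<^sub>R d \<in> edom f"
    using interior_add_scaleR[OF assms(2)] by blast
  have "z \<bullet> d \<le> egrad f y \<bullet> d"
  proof (rule GDERIV_directional_ge[OF ediff_at_egrad[OF assms(3)] e(1)])
    fix t :: real assume "0 < t" "t < e"
    then show "real_of_ereal (f y) + t * (z \<bullet> d) \<le> real_of_ereal (f (y + t *\<^sub>R d))"
      using assms(1) e(2) unfolding subgradient_def by fastforce
  qed
  then have "d \<bullet> d \<le> 0" unfolding d_def by (simp add: inner_diff_left)
  then have "d = 0" by (meson inner_eq_zero_iff inner_ge_zero order_antisym)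
  then show ?thesis by (simp add: d_def)
qed

text \<open>Two subgradient points for the same \<open>z\<close> would make \<open>f\<close> affine
  between them. As \<open>y'\<close> may lie on the boundary, strict convexity is applied between
  \<open>y\<close> and the interior midpoint \<open>p\<close>, at their own midpoint
  \<open>q\<close>.\<close>

lemma subgradient_unique_point:
  fixes f :: "'a::euclidean_space \<Rightarrow> ereal"
  assumes "proper f" "convex (eepigraph f)" "strictly_convex_on (interior (edom f)) f"
    and y: "subgradient f z y" "y \<in> interior (edom f)" and y': "subgradient f z y'"
  shows "y' = y"
proof (rule ccontr)
  assume ne: "y' \<noteq> y"
  define F where "F = (\<lambda>u. real_of_ereal (f u))"
  have dom: "y \<in> edom f" "y' \<in> edom f" using y(1) y' by (auto simp: subgradient_def)
  define p where "p = (1 - 1/2) *\<^sub>R y + (1/2) *\<^sub>R y'"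
  have p: "p \<in> interior (edom f)"
  proof -
    have "y' - (1/2) *\<^sub>R (y' - y) \<in> interior (edom f)"
      using mem_interior_convex_shrink[OF convex_edom[OF assms(1,2)] y(2) dom(2)] by simp
    moreover have "p = y' - (1/2) *\<^sub>R (y' - y)"
      by (simp add: p_def algebra_simps flip: scaleR_add_left)
    ultimately show ?thesis by simp
  qed
  have pdom: "p \<in> edom f" using p interior_subset by blast
  have "p - y = (1/2) *\<^sub>R (y' - y)" by (simp add: p_def algebra_simps flip: scaleR_add_left)
  then have pne: "p \<noteq> y" using ne by auto
  define q where "q = (1 - 1/2) *\<^sub>R y + (1/2) *\<^sub>R p"
  have qdom: "q \<in> edom f" unfolding q_def
    by (rule convex_fun_combination(1)[OF assms(1,2) dom(1) pdom]) auto
  have "f q < ereal (1 - 1/2) * f y + ereal (1/2) * f p"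
    using assms(3)[unfolded strictly_convex_on_def, THEN conjunct2, rule_format, OF y(2) p, of "1/2"] pne
    by (simp add: q_def)
  moreover have "f y = ereal (F y)" "f p = ereal (F p)" "f q = ereal (F q)"
    using proper_eq_ereal[OF assms(1)] dom(1) pdom qdom unfolding F_def by blast+
  ultimately have lt: "F q < (1/2) * F y + (1/2) * F p" by simp
  have "F p \<le> (1/2) * F y + (1/2) * F y'"
    using convex_fun_combination(2)[OF assms(1,2) dom, of "1/2"] by (simp add: p_def F_def)
  moreover have "F y + z \<bullet> (q - y) \<le> F q" using y(1) qdom by (simp add: subgradient_def F_def)
  moreover have "F y' + z \<bullet> (y - y') \<le> F y" using y' dom(1) by (simp add: subgradient_def F_def)
  moreover have "z \<bullet> (q - y) = (1/4) * (z \<bullet> (y' - y))"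
    by (simp add: q_def p_def inner_diff_right inner_add_right)
  ultimately show False using lt by (simp add: inner_diff_right)
qed

text \<open>If \<open>z\<close> is a subgradient at \<open>y\<close>, the gradients along the segment from \<open>y\<close> to an interior
  point \<open>a\<close> stay bounded, because \<open>f - z\<close> is minimal at \<open>y\<close> and grows at most linearly on the
  cone with apex \<open>y\<close> over a ball around \<open>a\<close>. So \<open>y\<close> cannot be a boundary point.\<close>

lemma subgradient_interior:
  fixes f :: "'a::euclidean_space \<Rightarrow> ereal"
  assumes "proper f" "convex (eepigraph f)" "essentially_smooth f"
    and "interior (edom f) \<noteq> {}" and y: "subgradient f z y"
  shows "y \<in> interior (edom f)"
proof (rule ccontr)
  assume nint: "y \<notin> interior (edom f)"
  define F where "F = (\<lambda>u. real_of_ereal (f u))"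
  have ydom: "y \<in> edom f" using y by (simp add: subgradient_def)
  then have fr: "y \<in> frontier (edom f)" using nint closure_subset by (auto simp: frontier_def)
  have cvx: "convex (edom f)" using convex_edom assms(1,2) by blast
  obtain a where a: "a \<in> interior (edom f)" using assms(4) by blast
  obtain r where r: "0 < r" "cball a r \<subseteq> interior (edom f)"
    using a open_contains_cball[of "interior (edom f)"] by auto
  have "convex_on (interior (edom f)) F"
  proof (rule convex_onI)
    fix t :: real and u v assume "0 < t" "t < 1" "u \<in> interior (edom f)" "v \<in> interior (edom f)"
    then show "F ((1 - t) *\<^sub>R u + t *\<^sub>R v) \<le> (1 - t) * F u + t * F v"
      unfolding F_def
      using convex_fun_combination(2)[OF assms(1,2), of u v t] interior_subset[of "edom f"] by auto
  qed (rule convex_interior[OF cvx])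
  then have "continuous_on (cball a r) F"
    using convex_on_continuous[of "interior (edom f)" F] r(2) continuous_on_subset by blast
  then have "compact (F ` cball a r)" by (intro compact_continuous_image) auto
  then have "bdd_above (F ` cball a r)" by (intro bounded_imp_bdd_above compact_imp_bounded)
  then obtain M where M: "\<And>v. v \<in> cball a r \<Longrightarrow> F v \<le> M"
    unfolding bdd_above.unfold by blast
  \<comment> \<open>\<open>B\<close> is the bound on the gradients that the final estimate produces,
    as it shows that \<open>norm (g - z)\<close> is at most \<open>B - norm z\<close>. The points
    \<open>X k\<close> tend to \<open>y\<close> through the interior, so their gradients must exceed
    \<open>B\<close> eventually.\<close>
  define B where "B = (M - F y + norm z * (norm (a - y) + r)) / r + norm z"
  define X where "X = (\<lambda>k. y + inverse (real (Suc k)) *\<^sub>R (a - y))"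
  have Xeq: "X k = y - inverse (real (Suc k)) *\<^sub>R (y - a)" for k
    by (simp add: X_def algebra_simps)
  have Xint: "X k \<in> interior (edom f)" for k
    unfolding Xeq
    by (rule mem_interior_convex_shrink[OF cvx a ydom]) (auto simp: field_simps)
  have "X \<longlonglongrightarrow> y + 0 *\<^sub>R (a - y)"
    unfolding X_def by (intro tendsto_intros LIMSEQ_inverse_real_of_nat)
  then have "filterlim (\<lambda>k. norm (egrad f (X k))) at_top sequentially"
    using assms(3) Xint fr unfolding essentially_smooth_def scaleR_zero_left add_0_right by blast
  then obtain k where k: "B < norm (egrad f (X k))"
    by (metis (mono_tags, lifting) filterlim_at_top_dense eventually_sequentially order_refl)
  define t where "t = inverse (real (Suc k))"
  have t: "0 < t" "t \<le> 1" by (auto simp: t_def field_simps)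
  define g where "g = egrad f (X k)"
  have sg: "subgradient f g (X k)" unfolding g_def
    using subgradient_egrad[OF assms(1,2)] Xint assms(3) interior_subset
    unfolding essentially_smooth_def by blast
  \<comment> \<open>This is the displacement of length \<open>r\<close> along which
    \<open>g - z\<close> grows fastest; \<open>a + e\<close> is still in the ball on which
    \<open>F\<close> is at most \<open>M\<close>.\<close>
  define e where "e = (r / norm (g - z)) *\<^sub>R (g - z)"
  \<comment> \<open>Since \<open>norm g\<close> exceeds \<open>B\<close>, this rules out
    \<open>g = z\<close>, for which \<open>e\<close> would degenerate.\<close>
  have "norm z \<le> B"
  proof -
    have "F y + z \<bullet> (a - y) \<le> F a" using y a interior_subset by (auto simp: subgradient_def F_def)
    moreover have "F a \<le> M" using M r(1) by simp
    moreover have "- (norm z * norm (a - y)) \<le> z \<bullet> (a - y)"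
      using Cauchy_Schwarz_ineq2[of z "a - y"] by linarith
    moreover have "0 \<le> norm z * r" using r(1) by simp
    ultimately have "0 \<le> M - F y + norm z * (norm (a - y) + r)" by (simp add: algebra_simps)
    then show ?thesis using r(1) by (simp add: B_def)
  qed
  with k have gz: "g \<noteq> z" by (auto simp: g_def)
  have ne: "norm e = r" using gz r(1) by (simp add: e_def)
  have ae: "a + e \<in> cball a r" using ne by (simp add: dist_norm)
  then have aedom: "a + e \<in> edom f" using r(2) interior_subset by blast
  have pt: "(1 - t) *\<^sub>R y + t *\<^sub>R (a + e) = X k + t *\<^sub>R e"
    by (simp add: X_def t_def algebra_simps)
  have "X k + t *\<^sub>R e \<in> edom f" "F (X k + t *\<^sub>R e) \<le> (1 - t) * F y + t * F (a + e)"
    using convex_fun_combination[OF assms(1,2) ydom aedom, of t] t pt by (auto simp: F_def)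
  moreover have "F (X k) + g \<bullet> (X k + t *\<^sub>R e - X k) \<le> F (X k + t *\<^sub>R e)"
    using sg calculation(1) unfolding subgradient_def F_def by blast
  moreover have "F y + z \<bullet> (X k - y) \<le> F (X k)"
    using y Xint[of k] interior_subset unfolding subgradient_def F_def by blast
  moreover have "X k - y = t *\<^sub>R (a - y)" by (simp add: X_def t_def)
  moreover have "t * F (a + e) \<le> t * M" using M[OF ae] t by simp
  ultimately have "t * (g \<bullet> e) \<le> t * (M - F y - z \<bullet> (a - y))"
    by (simp add: algebra_simps)
  then have "g \<bullet> e \<le> M - F y - z \<bullet> (a - y)" using t by simp
  moreover have "(g - z) \<bullet> e = r * norm (g - z)"
    using gz by (simp add: e_def power2_norm_eq_inner[symmetric] power2_eq_square)
  ultimately have "r * norm (g - z) \<le> M - F y - z \<bullet> (a - y) - z \<bullet> e"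
    by (simp add: inner_diff_left)
  moreover have "- (z \<bullet> (a - y)) \<le> norm z * norm (a - y)" "- (z \<bullet> e) \<le> norm z * r"
    using Cauchy_Schwarz_ineq2[of z "a - y"] Cauchy_Schwarz_ineq2[of z e] by (simp_all add: ne)
  ultimately have "r * norm (g - z) \<le> M - F y + norm z * (norm (a - y) + r)"
    by (simp add: algebra_simps)
  then have "norm (g - z) \<le> B - norm z" using r(1) by (simp add: B_def field_simps)
  moreover have "norm g \<le> norm (g - z) + norm z" by (metis diff_add_cancel norm_triangle_ineq)
  ultimately show False using k by (simp add: g_def)
qed

section \<open>Conjugates of Legendre functions\<close>

lemma conjugate_ge:
  assumes "proper f" "u \<in> edom f"
  shows "ereal (z \<bullet> u - real_of_ereal (f u)) \<le> conjugate f z"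
  unfolding conjugate_def
  by (rule SUP_upper2[of u]) (use proper_eq_ereal[OF assms] in \<open>auto, metis ereal_minus(1) order_refl\<close>)

lemma conjugate_le:
  assumes "proper f" "\<And>u. u \<in> edom f \<Longrightarrow> z \<bullet> u - real_of_ereal (f u) \<le> c"
  shows "conjugate f z \<le> ereal c"
  unfolding conjugate_def
proof (rule SUP_least)
  fix u
  show "ereal (z \<bullet> u) - f u \<le> ereal c"
  proof (cases "u \<in> edom f")
    case True
    then show ?thesis
      using proper_eq_ereal[OF assms(1)] assms(2) by (metis ereal_less_eq(3) ereal_minus(1))
  next
    case False
    then have "f u = \<infinity>" by (simp add: edom_def)
    then show ?thesis by simp
  qed
qed

text \<open>Any point of the effective domain of \<open>f\<close> gives a real lower bound, so the
  conjugate is never \<open>-\<infinity>\<close>.\<close>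

lemma conjugate_eq_ereal:
  assumes "proper f" "z \<in> edom (conjugate f)"
  shows "conjugate f z = ereal (real_of_ereal (conjugate f z))"
proof -
  obtain u where "u \<in> edom f" using assms(1) by (auto simp: proper_def edom_def)
  from conjugate_ge[OF assms(1) this, of z] assms(2) show ?thesis
    by (cases "conjugate f z") (auto simp: edom_def)
qed

lemma fenchel_young:
  assumes "proper f" "z \<in> edom (conjugate f)" "u \<in> edom f"
  shows "z \<bullet> u - real_of_ereal (f u) \<le> real_of_ereal (conjugate f z)"
  using conjugate_ge[OF assms(1,3)] conjugate_eq_ereal[OF assms(1,2)] by (metis ereal_less_eq(3))

text \<open>This is the equality case of the Fenchel-Young inequality; one direction suffices
  because the reverse inequality always holds.\<close>

lemma subgradient_iff_conjugate:
  assumes "proper f" "z \<in> edom (conjugate f)"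
  shows "subgradient f z y \<longleftrightarrow>
    y \<in> edom f \<and> real_of_ereal (conjugate f z) \<le> z \<bullet> y - real_of_ereal (f y)"
proof
  assume y: "subgradient f z y"
  have "conjugate f z \<le> ereal (z \<bullet> y - real_of_ereal (f y))"
    by (rule conjugate_le[OF assms(1)])
      (use y in \<open>force simp: subgradient_def inner_diff_right\<close>)
  then show "y \<in> edom f \<and> real_of_ereal (conjugate f z) \<le> z \<bullet> y - real_of_ereal (f y)"
    using y conjugate_eq_ereal[OF assms] unfolding subgradient_def by (metis ereal_less_eq(3))
next
  assume "y \<in> edom f \<and> real_of_ereal (conjugate f z) \<le> z \<bullet> y - real_of_ereal (f y)"
  then show "subgradient f z y"
    using fenchel_young[OF assms] by (force simp: subgradient_def inner_diff_right)
qed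

lemma conjugate_combination:
  assumes "proper f" "z \<in> edom (conjugate f)" "w \<in> edom (conjugate f)" "0 \<le> t" "t \<le> 1"
  shows "conjugate f ((1 - t) *\<^sub>R z + t *\<^sub>R w)
    \<le> ereal ((1 - t) * real_of_ereal (conjugate f z) + t * real_of_ereal (conjugate f w))"
proof (rule conjugate_le[OF assms(1)])
  fix u assume u: "u \<in> edom f"
  have "(1 - t) * (z \<bullet> u - real_of_ereal (f u)) + t * (w \<bullet> u - real_of_ereal (f u))
      \<le> (1 - t) * real_of_ereal (conjugate f z) + t * real_of_ereal (conjugate f w)"
    using fenchel_young[OF assms(1) _ u] assms(2-5) by (intro add_mono mult_left_mono) auto
  then show "((1 - t) *\<^sub>R z + t *\<^sub>R w) \<bullet> u - real_of_ereal (f u)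
      \<le> (1 - t) * real_of_ereal (conjugate f z) + t * real_of_ereal (conjugate f w)"
    by (simp add: inner_add_left algebra_simps)
qed

text \<open>The conjugate is convex as a supremum of affine functions, and a finite convex function
  on an open set in finite dimension is continuous.\<close>

lemma continuous_on_conjugate:
  fixes f :: "'a::euclidean_space \<Rightarrow> ereal"
  assumes "proper f"
  shows "continuous_on (interior (edom (conjugate f))) (\<lambda>z. real_of_ereal (conjugate f z))"
proof (rule convex_on_continuous[OF open_interior])
  have cvx: "convex (edom (conjugate f))"
    unfolding convex_alt
  proof (intro ballI allI impI)
    fix z w and t :: real
    assume "z \<in> edom (conjugate f)" "w \<in> edom (conjugate f)" "0 \<le> t \<and> t \<le> 1"
    from conjugate_combination[OF assms this(1,2), of t] this(3)
    show "(1 - t) *\<^sub>R z + t *\<^sub>R w \<in> edom (conjugate f)"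
      by (auto simp: edom_def intro: le_less_trans)
  qed
  show "convex_on (interior (edom (conjugate f))) (\<lambda>z. real_of_ereal (conjugate f z))"
  proof (rule convex_onI)
    fix t :: real and z w
    assume t: "0 < t" "t < 1"
      and z: "z \<in> interior (edom (conjugate f))" and w: "w \<in> interior (edom (conjugate f))"
    have "(1 - t) *\<^sub>R z + t *\<^sub>R w \<in> interior (edom (conjugate f))"
      using convexD_alt[OF convex_interior[OF cvx] z w] t by simp
    then have "(1 - t) *\<^sub>R z + t *\<^sub>R w \<in> edom (conjugate f)" using interior_subset by blast
    from conjugate_eq_ereal[OF assms this] conjugate_combination[OF assms, of z w t] z w t
    show "real_of_ereal (conjugate f ((1 - t) *\<^sub>R z + t *\<^sub>R w))
        \<le> (1 - t) * real_of_ereal (conjugate f z) + t * real_of_ereal (conjugate f w)"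
      using interior_subset by (metis ereal_less_eq(3) less_imp_le subsetD)
  qed (rule convex_interior[OF cvx])
qed

text \<open>Boundedness of \<open>Y\<close> comes from testing the Fenchel--Young inequality at \<open>Z k + (r/2) e\<close>
  with \<open>e\<close> the direction of \<open>Y k\<close>, as the conjugate is bounded near \<open>z\<close>.\<close>

lemma approximate_subgradients_subsequence:
  fixes f :: "'a::euclidean_space \<Rightarrow> ereal"
  assumes "proper f" "closed (eepigraph f)" and z: "z \<in> interior (edom (conjugate f))"
    and Z: "Z \<longlonglongrightarrow> z" and c: "c \<longlonglongrightarrow> real_of_ereal (conjugate f z)"
    and Y: "\<And>k. Y k \<in> edom f" "\<And>k. c k \<le> Z k \<bullet> Y k - real_of_ereal (f (Y k))"
  obtains y s where "strict_mono s" "(Y \<circ> s) \<longlonglongrightarrow> y" "subgradient f z y"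
proof -
  define K where "K = (\<lambda>w. real_of_ereal (conjugate f w))"
  obtain r where r: "0 < r" "cball z r \<subseteq> interior (edom (conjugate f))"
    using z open_contains_cball[of "interior (edom (conjugate f))"] by auto
  have "continuous_on (cball z r) K"
    using continuous_on_conjugate[OF assms(1)] r(2) continuous_on_subset unfolding K_def by blast
  then have "compact (K ` cball z r)" by (intro compact_continuous_image) auto
  then have "bdd_above (K ` cball z r)" by (intro bounded_imp_bdd_above compact_imp_bounded)
  then obtain M where M: "\<And>v. v \<in> cball z r \<Longrightarrow> K v \<le> M"
    unfolding bdd_above.unfold by blast
  have "\<forall>\<^sub>F k in sequentially. dist (Z k) z < r / 2"
    using Z r(1) by (intro tendstoD) auto
  moreover have "\<forall>\<^sub>F k in sequentially. K z - 1 < c k"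
    using c by (intro order_tendstoD) (auto simp: K_def)
  ultimately obtain N where N: "\<And>k. N \<le> k \<Longrightarrow> dist (Z k) z < r / 2" "\<And>k. N \<le> k \<Longrightarrow> K z - 1 < c k"
    by (metis (mono_tags, lifting) eventually_conj eventually_sequentially)
  have "norm (Y (k + N)) \<le> 2 * (M - K z + 1) / r" for k
  proof -
    let ?k = "k + N"
    \<comment> \<open>If \<open>Y ?k = 0\<close>, division by zero makes \<open>e = 0\<close> and
      both estimates on \<open>e\<close> remain true.\<close>
    define e where "e = (r / 2 / norm (Y ?k)) *\<^sub>R Y ?k"
    have "norm e \<le> r / 2" using r(1) by (simp add: e_def)
    then have "dist (Z ?k + e) z \<le> r"
      using N(1)[of ?k] norm_triangle_ineq[of "Z ?k - z" e] by (simp add: dist_norm algebra_simps)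
    then have in_ball: "Z ?k + e \<in> cball z r" by (simp add: dist_commute)
    then have "(Z ?k + e) \<bullet> Y ?k - real_of_ereal (f (Y ?k)) \<le> K (Z ?k + e)"
      unfolding K_def using r(2) interior_subset by (intro fenchel_young[OF assms(1) _ Y(1)]) blast
    moreover have "e \<bullet> Y ?k = r / 2 * norm (Y ?k)"
      by (simp add: e_def power2_norm_eq_inner[symmetric] power2_eq_square)
    ultimately have "r / 2 * norm (Y ?k) \<le> M - K z + 1"
      using Y(2)[of ?k] N(2)[of ?k] M[OF in_ball] by (simp add: inner_add_left)
    then show ?thesis using r(1) by (simp add: field_simps)
  qed
  then have "bounded (range (\<lambda>k. Y (k + N)))" unfolding bounded_iff by blast
  then obtain y s where s: "strict_mono (s :: nat \<Rightarrow> nat)" "((\<lambda>k. Y (k + N)) \<circ> s) \<longlonglongrightarrow> y"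
    using bounded_imp_convergent_subsequence by blast
  define s' where "s' = (\<lambda>k. s k + N)"
  have s': "strict_mono s'" "(Y \<circ> s') \<longlonglongrightarrow> y"
    using s by (auto simp: s'_def strict_mono_def o_def)
  have "(\<lambda>k. (Z \<circ> s') k \<bullet> (Y \<circ> s') k - (c \<circ> s') k) \<longlonglongrightarrow> z \<bullet> y - K z"
    using LIMSEQ_subseq_LIMSEQ[OF Z s'(1)] LIMSEQ_subseq_LIMSEQ[OF c s'(1)] s'(2)
    unfolding K_def by (intro tendsto_intros)
  \<comment> \<open>The inequality passes to the limit through the closed epigraph, which stands in
    for lower semicontinuity of \<open>f\<close>.\<close>
  then have lim: "(\<lambda>k. ((Y \<circ> s') k, (Z \<circ> s') k \<bullet> (Y \<circ> s') k - (c \<circ> s') k)) \<longlonglongrightarrow> (y, z \<bullet> y - K z)"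
    using s'(2) by (intro tendsto_Pair)
  have mem: "((Y \<circ> s') k, (Z \<circ> s') k \<bullet> (Y \<circ> s') k - (c \<circ> s') k) \<in> eepigraph f" for k
  proof -
    have "f (Y (s' k)) = ereal (real_of_ereal (f (Y (s' k))))"
      by (rule proper_eq_ereal[OF assms(1) Y(1)])
    also have "\<dots> \<le> ereal (Z (s' k) \<bullet> Y (s' k) - c (s' k))" using Y(2)[of "s' k"] by simp
    finally show ?thesis by (simp add: eepigraph_def)
  qed
  have "(y, z \<bullet> y - K z) \<in> eepigraph f"
    by (rule closed_sequentially[OF assms(2) mem lim])
  then have le: "f y \<le> ereal (z \<bullet> y - K z)" by (simp add: eepigraph_def)
  then have ydom: "y \<in> edom f" by (auto simp: edom_def intro: le_less_trans)
  have "real_of_ereal (f y) \<le> z \<bullet> y - K z"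
    using le proper_eq_ereal[OF assms(1) ydom] by (metis ereal_less_eq(3))
  then have "subgradient f z y"
    using z interior_subset ydom by (subst subgradient_iff_conjugate[OF assms(1)]) (auto simp: K_def)
  with s' that show thesis by blast
qed

text \<open>A maximizing sequence for the supremum defining \<open>conjugate f z\<close> consists of
  approximate subgradient points for the constant dual point \<open>z\<close>, and its cluster point
  attains the supremum.\<close>

lemma subgradient_exists:
  fixes f :: "'a::euclidean_space \<Rightarrow> ereal"
  assumes "proper f" "closed (eepigraph f)" "z \<in> interior (edom (conjugate f))"
  shows "\<exists>y. subgradient f z y"
proof -
  define K where "K = real_of_ereal (conjugate f z)"
  have zdom: "z \<in> edom (conjugate f)" using assms(3) interior_subset by blast
  have "\<exists>y\<in>edom f. K - inverse (real (Suc k)) \<le> z \<bullet> y - real_of_ereal (f y)" for k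
  proof (rule ccontr)
    assume "\<not> ?thesis"
    then have "conjugate f z \<le> ereal (K - inverse (real (Suc k)))"
      by (intro conjugate_le[OF assms(1)]) (auto simp: not_le intro: less_imp_le)
    then have "K \<le> K - inverse (real (Suc k))"
      using conjugate_eq_ereal[OF assms(1) zdom] unfolding K_def by (metis ereal_less_eq(3))
    then show False by (simp add: field_simps)
  qed
  then obtain Y where Y: "\<And>k. Y k \<in> edom f"
    "\<And>k. K - inverse (real (Suc k)) \<le> z \<bullet> Y k - real_of_ereal (f (Y k))"
    by metis
  have "(\<lambda>k. K - inverse (real (Suc k))) \<longlonglongrightarrow> K - 0"
    by (intro tendsto_intros LIMSEQ_inverse_real_of_nat)
  then have "(\<lambda>k. K - inverse (real (Suc k))) \<longlonglongrightarrow> real_of_ereal (conjugate f z)"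
    by (simp add: K_def)
  from approximate_subgradients_subsequence[OF assms(1-3) tendsto_const this Y]
  show ?thesis by blast
qed

text \<open>Uniqueness makes any selection \<open>Y\<close> of subgradient points continuous at
  \<open>z\<close>. Fenchel-Young at \<open>w\<close> and at \<open>z\<close> then squeezes the
  linearization error of the conjugate between 0 and
  \<open>(w - z) \<bullet> (Y w - y)\<close>.\<close>

lemma subgradient_unique_imp_egrad_conjugate:
  fixes f :: "'a::euclidean_space \<Rightarrow> ereal"
  assumes "proper f" "closed (eepigraph f)" and z: "z \<in> interior (edom (conjugate f))"
    and y: "subgradient f z y" and unique: "\<And>y'. subgradient f z y' \<Longrightarrow> y' = y"
  shows "egrad (conjugate f) z = y"
proof (rule egrad_eqI)
  define I where "I = interior (edom (conjugate f))"
  define K where "K = (\<lambda>w. real_of_ereal (conjugate f w))"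
  define Y where "Y = (\<lambda>w. SOME y. subgradient f w y)"
  have Y: "subgradient f w (Y w)" if "w \<in> I" for w
    using someI_ex[OF subgradient_exists[OF assms(1,2)]] that unfolding Y_def I_def by blast
  have Idom: "w \<in> edom (conjugate f)" if "w \<in> I" for w
    using that interior_subset unfolding I_def by blast
  \<comment> \<open>Otherwise points \<open>W k\<close> tending to \<open>z\<close> keep
    \<open>Y (W k)\<close> away from \<open>y\<close>, although a subsequence of these values
    converges to a subgradient point for \<open>z\<close>, which can only be
    \<open>y\<close>.\<close>
  have near: "\<exists>d>0. \<forall>w. norm (w - z) < d \<longrightarrow> w \<in> I \<and> norm (Y w - y) < e" if e: "0 < e" for e
  proof (rule ccontr)
    assume neg: "\<not> ?thesis"
    obtain r where r: "0 < r" "ball z r \<subseteq> I"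
      using z open_contains_ball[of I] unfolding I_def by auto
    have "\<exists>w\<in>I. norm (w - z) < inverse (real (Suc k)) \<and> e \<le> norm (Y w - y)" for k
    proof -
      have "0 < min r (inverse (real (Suc k)))" using r(1) by simp
      then obtain w where w: "norm (w - z) < min r (inverse (real (Suc k)))"
        "\<not> (w \<in> I \<and> norm (Y w - y) < e)" using neg by blast
      moreover have "w \<in> ball z r" using w(1) by (simp add: dist_norm norm_minus_commute)
      ultimately show ?thesis using r(2) by force
    qed
    then obtain W where W: "\<And>k. W k \<in> I" "\<And>k. norm (W k - z) < inverse (real (Suc k))"
      "\<And>k. e \<le> norm (Y (W k) - y)" by metis
    have "(\<lambda>k. W k - z) \<longlonglongrightarrow> 0"
      by (rule Lim_null_comparison[OF _ LIMSEQ_inverse_real_of_nat])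
        (use W(2) in \<open>simp add: less_imp_le\<close>)
    then have Wz: "W \<longlonglongrightarrow> z" by (simp add: LIM_zero_iff)
    have "continuous (at z) K"
      using continuous_on_conjugate[OF assms(1)] z
      unfolding K_def by (simp add: continuous_on_eq_continuous_at)
    then have "(\<lambda>k. K (W k)) \<longlonglongrightarrow> K z"
      using Wz isCont_tendsto_compose by blast
    moreover have "Y (W k) \<in> edom f" for k using Y[OF W(1)] by (simp add: subgradient_def)
    moreover have "K (W k) \<le> W k \<bullet> Y (W k) - real_of_ereal (f (Y (W k)))" for k
      using Y[OF W(1)] subgradient_iff_conjugate[OF assms(1) Idom[OF W(1)]] unfolding K_def by blast
    ultimately obtain y' s where y': "((\<lambda>k. Y (W k)) \<circ> s) \<longlonglongrightarrow> y'" "subgradient f z y'"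
      using approximate_subgradients_subsequence[OF assms(1,2) z Wz, of "\<lambda>k. K (W k)" "\<lambda>k. Y (W k)"]
      unfolding K_def by blast
    have "(\<lambda>k. norm (Y (W (s k)) - y)) \<longlonglongrightarrow> norm (y - y)"
      using y'(1) unique[OF y'(2)] unfolding o_def by (intro tendsto_intros) simp
    then have "e \<le> norm (y - y)"
      by (rule LIMSEQ_le_const) (use W(3) in auto)
    then show False using e by simp
  qed
  have zI: "z \<in> I" using z by (simp add: I_def)
  have fy: "K z \<le> z \<bullet> y - real_of_ereal (f y)" "y \<in> edom f"
    using y subgradient_iff_conjugate[OF assms(1) Idom[OF zI]] unfolding K_def by auto
  have "(K has_derivative (\<lambda>h. h \<bullet> y)) (at z)"
    unfolding has_derivative_at_alt
  proof (intro conjI allI impI)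
    show "bounded_linear (\<lambda>h. h \<bullet> y)" by (rule bounded_linear_inner_left)
    fix e :: real assume "0 < e"
    then obtain d where d: "0 < d"
      "\<And>w. norm (w - z) < d \<Longrightarrow> w \<in> I" "\<And>w. norm (w - z) < d \<Longrightarrow> norm (Y w - y) < e"
      using near by blast
    show "\<exists>d>0. \<forall>w. norm (w - z) < d \<longrightarrow> norm (K w - K z - (w - z) \<bullet> y) \<le> e * norm (w - z)"
    proof (intro exI[of _ d] conjI allI impI d(1))
      fix w assume w: "norm (w - z) < d"
      note wI = d(2)[OF w]
      have Yw: "Y w \<in> edom f" "K w \<le> w \<bullet> Y w - real_of_ereal (f (Y w))"
        using Y[OF wI] subgradient_iff_conjugate[OF assms(1) Idom[OF wI]] unfolding K_def by auto
      have "w \<bullet> y - real_of_ereal (f y) \<le> K w" "z \<bullet> Y w - real_of_ereal (f (Y w)) \<le> K z"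
        unfolding K_def using fenchel_young[OF assms(1)] Idom wI zI fy(2) Yw(1) by blast+
      then have "0 \<le> K w - K z - (w - z) \<bullet> y" "K w - K z - (w - z) \<bullet> y \<le> (w - z) \<bullet> (Y w - y)"
        using fy(1) Yw(2) by (auto simp: inner_diff_left inner_diff_right)
      moreover have "(w - z) \<bullet> (Y w - y) \<le> norm (w - z) * norm (Y w - y)"
        by (rule norm_cauchy_schwarz)
      moreover have "norm (w - z) * norm (Y w - y) \<le> norm (w - z) * e"
        using d(3)[OF w] by (intro mult_left_mono) auto
      ultimately show "norm (K w - K z - (w - z) \<bullet> y) \<le> e * norm (w - z)"
        by (simp add: mult.commute)
    qed
  qed
  then show "GDERIV (\<lambda>w. real_of_ereal (conjugate f w)) z :> y"
    by (simp add: gderiv_def K_def)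
qed

text \<open>A subgradient point for \<open>z\<close> exists because \<open>z\<close> is interior to
  the conjugate domain. Essential smoothness places it in the interior of \<open>edom f\<close>, and
  strict convexity makes it unique.\<close>

lemma legendre_egrad_conjugate:
  fixes f :: "'a::euclidean_space \<Rightarrow> ereal"
  assumes "legendre f" "interior (edom f) \<noteq> {}" "z \<in> interior (edom (conjugate f))"
  shows "egrad (conjugate f) z \<in> interior (edom f)"
    and "egrad f (egrad (conjugate f) z) = z"
    and "\<And>y. \<lbrakk>y \<in> interior (edom f); egrad f y = z\<rbrakk> \<Longrightarrow> egrad (conjugate f) z = y"
proof -
  have f: "proper f" "closed (eepigraph f)" "convex (eepigraph f)" "essentially_smooth f"
    "strictly_convex_on (interior (edom f)) f"
    using assms(1) by (auto simp: legendre_def closed_convex_fun_def)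
  have diff: "ediff_at f u" if "u \<in> interior (edom f)" for u
    using that f(4) by (simp add: essentially_smooth_def)
  have eq: "egrad (conjugate f) z = y \<and> y \<in> interior (edom f)" if y: "subgradient f z y" for y
  proof -
    have "y \<in> interior (edom f)"
      by (rule subgradient_interior[OF f(1,3,4) assms(2) y])
    then show ?thesis
      using subgradient_unique_imp_egrad_conjugate[OF f(1,2) assms(3) y]
        subgradient_unique_point[OF f(1,3,5) y] by blast
  qed
  obtain y where y: "subgradient f z y"
    using subgradient_exists[OF f(1,2) assms(3)] by blast
  with eq show int: "egrad (conjugate f) z \<in> interior (edom f)" by blast
  show "egrad f (egrad (conjugate f) z) = z"
    using subgradient_imp_egrad[OF y] eq[OF y] diff by simp
  show "egrad (conjugate f) z = u" if "u \<in> interior (edom f)" "egrad f u = z" for u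
    using subgradient_egrad[OF f(1,3), of u] eq[of u] diff that interior_subset by blast
qed


section \<open>Saddle points of the regularized gap function\<close>

text \<open>The minimax step: a separation argument in \<open>'a \<times> real\<close> against the half-line
  \<open>{0} \<times> {..0}\<close>.\<close>

lemma compact_convex_nonpos_at_zero:
  fixes K :: "('a::euclidean_space \<times> real) set"
  assumes "compact K" "convex K" "K \<noteq> {}"
    and nonpos: "\<And>h. \<exists>(q, r)\<in>K. q \<bullet> h + r \<le> 0"
  obtains r where "(0, r) \<in> K" "r \<le> 0"
proof (rule ccontr)
  assume neg: "\<not> thesis"
  define L :: "('a \<times> real) set" where "L = {0} \<times> {..0}"
  have "K \<inter> L = {}" using neg that by (auto simp: L_def)
  moreover have "convex L" "closed L"
    by (auto simp: L_def intro: convex_Times closed_Times)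
  ultimately obtain a b where ab: "\<And>k. k \<in> K \<Longrightarrow> a \<bullet> k < b" "\<And>k. k \<in> L \<Longrightarrow> b < a \<bullet> k"
    using separating_hyperplane_compact_closed[of K L] assms(1-3) by blast
  obtain p \<alpha> where a: "a = (p, \<alpha>)" by (cases a)
  have K: "p \<bullet> q + \<alpha> * r < b" if "(q, r) \<in> K" for q r
    using ab(1)[OF that] by (simp add: a)
  have L: "b < \<alpha> * r" if "r \<le> 0" for r
    using ab(2)[of "(0, r)"] that by (simp add: a L_def)
  have b: "b < 0" using L[of 0] by simp
  have "\<alpha> \<le> 0"
  proof (rule ccontr)
    assume "\<not> \<alpha> \<le> 0"
    then show False using L[of "b / \<alpha>"] b by (simp add: divide_nonpos_pos)
  qed
  then consider "\<alpha> < 0" | "\<alpha> = 0" by linarith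
  then show False
  proof cases
    \<comment> \<open>Testing with \<open>h = p / \<alpha>\<close> turns the separating functional
      into \<open>\<alpha>\<close> times \<open>q \<bullet> h + r\<close>, a product of two
      nonpositive numbers, although separation makes it negative.\<close>
    case 1
    obtain q r where qr: "(q, r) \<in> K" "q \<bullet> ((1 / \<alpha>) *\<^sub>R p) + r \<le> 0" using nonpos by blast
    have "\<alpha> * (q \<bullet> ((1 / \<alpha>) *\<^sub>R p) + r) = p \<bullet> q + \<alpha> * r"
      using 1 by (simp add: distrib_left inner_commute)
    moreover have "0 \<le> \<alpha> * (q \<bullet> ((1 / \<alpha>) *\<^sub>R p) + r)"
      using 1 qr(2) by (intro mult_nonpos_nonpos) auto
    ultimately show False using K[OF qr(1)] b by simp
  next
    \<comment> \<open>Here the hyperplane is vertical and says nothing about \<open>r\<close>. Since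
      \<open>p \<bullet> q < b < 0\<close>, the scaling \<open>R / b\<close> makes
      \<open>q \<bullet> h\<close> exceed the bound \<open>R\<close> on all second
      components.\<close>
    case 2
    have "bounded (snd ` K)" using bounded_snd compact_imp_bounded assms(1) by blast
    then obtain R where R: "0 < R" "\<And>q r. (q, r) \<in> K \<Longrightarrow> \<bar>r\<bar> \<le> R"
      unfolding bounded_pos by force
    obtain q r where qr: "(q, r) \<in> K" "q \<bullet> ((R / b) *\<^sub>R p) + r \<le> 0" using nonpos by blast
    have "p \<bullet> q < b" using K[OF qr(1)] 2 by simp
    then have "R / b * b < R / b * (p \<bullet> q)"
      using R(1) b by (intro mult_strict_left_mono_neg) (auto simp: divide_pos_neg)
    then have "R < q \<bullet> ((R / b) *\<^sub>R p)" using b by (simp add: inner_commute)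
    then show False using qr(2) R(2)[OF qr(1)] by linarith
  qed
qed

section \<open>Bregman distances and the objective for a fixed weight\<close>

lemma bregman_eq_ereal:
  assumes "proper f" "u \<in> edom f" "y \<in> edom f"
  shows "bregman f u y =
    ereal (real_of_ereal (f u) - real_of_ereal (f y) - egrad f y \<bullet> (u - y))"
  using proper_eq_ereal[OF assms(1,2)] proper_eq_ereal[OF assms(1,3)] unfolding bregman_def
  by (metis ereal_minus(1))

lemma bregman_eq_infinity:
  assumes "proper f" "u \<notin> edom f" "y \<in> edom f"
  shows "bregman f u y = \<infinity>"
proof -
  have "f u = \<infinity>" using assms(2) by (simp add: edom_def)
  moreover obtain r where "f y = ereal r" using proper_eq_ereal[OF assms(1,3)] by blast
  ultimately show ?thesis by (simp add: bregman_def)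
qed

lemma bregman_nonneg:
  assumes "proper f" "subgradient f (egrad f y) y"
  shows "0 \<le> bregman f u y"
proof (cases "u \<in> edom f")
  case True
  moreover have "real_of_ereal (f y) + egrad f y \<bullet> (u - y) \<le> real_of_ereal (f u)" "y \<in> edom f"
    using assms(2) True by (auto simp: subgradient_def)
  ultimately show ?thesis using bregman_eq_ereal[OF assms(1)] by simp
next
  case False
  then show ?thesis
    using bregman_eq_infinity[OF assms(1) False] assms(2) by (simp add: subgradient_def)
qed

lemma gap_obj_le:
  assumes "d \<in> dual_generator C"
  shows "gap_obj C F f l x y \<le>
    ereal (d \<bullet> (jacobian F (at x) *v (x - y))) - ereal l * bregman f y x"
  unfolding gap_obj_def using assms by (rule INF_lower)

lemma inner_matrix_vector_mult:
  fixes A :: "real^'n^'m"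
  shows "d \<bullet> (A *v h) = (transpose A *v d) \<bullet> h"
  by (metis dot_lmul_matrix vector_transpose_matrix transpose_transpose)

text \<open>For fixed \<open>d\<close> the objective at \<open>y\<close> equals \<open>l (f x - f y - egrad f z \<bullet> (x - y))\<close>, which is
  concave in \<open>y\<close> with critical point \<open>z\<close>.\<close>

lemma gap_le_bregman:
  assumes f: "proper f" and x: "x \<in> edom f" and z: "subgradient f (egrad f z) z"
    and d: "d \<in> dual_generator C" and l: "0 < l"
    and egrad_z: "egrad f z = egrad f x - (1 / l) *\<^sub>R (transpose (jacobian F (at x)) *v d)"
  shows "gap C \<Omega> F f l x \<le> ereal l * bregman f x z"
  unfolding gap_def
proof (rule SUP_least)
  fix y
  let ?F = "\<lambda>u. real_of_ereal (f u)"
  have zdom: "z \<in> edom f" using z by (simp add: subgradient_def)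
  have Jd: "transpose (jacobian F (at x)) *v d = l *\<^sub>R (egrad f x - egrad f z)"
    unfolding egrad_z using l by simp
  show "gap_obj C F f l x y \<le> ereal l * bregman f x z"
  proof (cases "y \<in> edom f")
    case False
    have "gap_obj C F f l x y \<le> -\<infinity>"
      using gap_obj_le[OF d, of F f l x y] bregman_eq_infinity[OF f False x] l by simp
    then show ?thesis by simp
  next
    case True
    have "?F z + egrad f z \<bullet> (y - z) \<le> ?F y" using z True by (simp add: subgradient_def)
    \<comment> \<open>Three-point identity: the right side minus the left side is \<open>l\<close>
      times the Bregman distance from \<open>y\<close> to \<open>z\<close>.\<close>
    then have "l * ((egrad f x - egrad f z) \<bullet> (x - y) - (?F y - ?F x - egrad f x \<bullet> (y - x)))
        \<le> l * (?F x - ?F z - egrad f z \<bullet> (x - z))"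
      using l by (intro mult_left_mono) (auto simp: inner_diff_left inner_diff_right)
    moreover have "d \<bullet> (jacobian F (at x) *v (x - y)) = l * ((egrad f x - egrad f z) \<bullet> (x - y))"
      unfolding inner_matrix_vector_mult Jd by simp
    ultimately have "ereal (d \<bullet> (jacobian F (at x) *v (x - y))) - ereal l * bregman f y x
        \<le> ereal l * bregman f x z"
      unfolding bregman_eq_ereal[OF f True x] bregman_eq_ereal[OF f x zdom]
      by (simp add: right_diff_distrib)
    with gap_obj_le[OF d] show ?thesis by (rule order_trans)
  qed
qed

text \<open>The gradient equation makes \<open>d \<bullet> J (x - z)\<close>, with \<open>J\<close>
  the Jacobian at \<open>x\<close>, equal to \<open>l\<close> times the sum of the Bregman distances
  between \<open>x\<close> and \<open>z\<close> in both orders. Subtracting the regularizer leaves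
  \<open>l * D(x, z)\<close>, and by minimality of \<open>d\<close> no other weight gives
  less.\<close>

lemma bregman_le_gap_obj:
  assumes f: "proper f" and x: "x \<in> edom f" and z: "z \<in> edom f" and l: "0 < l"
    and least: "\<And>e. e \<in> dual_generator C \<Longrightarrow>
      d \<bullet> (jacobian F (at x) *v (x - z)) \<le> e \<bullet> (jacobian F (at x) *v (x - z))"
    and egrad_z: "egrad f z = egrad f x - (1 / l) *\<^sub>R (transpose (jacobian F (at x)) *v d)"
  shows "ereal l * bregman f x z \<le> gap_obj C F f l x z"
  unfolding gap_obj_def
proof (rule INF_greatest)
  fix e assume "e \<in> dual_generator C"
  note le = least[OF this]
  have Jd: "transpose (jacobian F (at x)) *v d = l *\<^sub>R (egrad f x - egrad f z)"
    unfolding egrad_z using l by simp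
  have "d \<bullet> (jacobian F (at x) *v (x - z)) = l * ((egrad f x - egrad f z) \<bullet> (x - z))"
    unfolding inner_matrix_vector_mult Jd by simp
  then have "l * (real_of_ereal (f x) - real_of_ereal (f z) - egrad f z \<bullet> (x - z))
      = d \<bullet> (jacobian F (at x) *v (x - z))
        - l * (real_of_ereal (f z) - real_of_ereal (f x) - egrad f x \<bullet> (z - x))"
    by (simp add: algebra_simps inner_diff_left inner_diff_right)
  then show "ereal l * bregman f x z
      \<le> ereal (e \<bullet> (jacobian F (at x) *v (x - z))) - ereal l * bregman f z x"
    using le bregman_eq_ereal[OF f x z] bregman_eq_ereal[OF f z x] by simp
qed

text \<open>Writing \<open>p = l (egrad f z - egrad f x)\<close>, maximality of \<open>z\<close> is linearized: along each
  segment from \<open>z\<close> the minimum over the dual generator is concave, while the Bregman term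
  deviates from its derivative \<open>p\<close> by a lower-order term.\<close>

lemma gap_obj_maximizer_direction:
  fixes f :: "real^'n \<Rightarrow> ereal"
  assumes C: "closed C" "convex C" "cone C" "pointed C"
    and f: "proper f" and x: "x \<in> edom f" and l: "0 < l"
    and z: "z \<in> interior (edom f)" "ediff_at f z"
    and max: "\<And>y. y \<in> edom f \<Longrightarrow> gap_obj C F f l x y \<le> gap_obj C F f l x z"
    and d: "d \<in> dual_generator C"
  shows "\<exists>e\<in>dual_generator C. e \<bullet> (jacobian F (at x) *v (x - z - h))
    - l * ((egrad f z - egrad f x) \<bullet> h) \<le> d \<bullet> (jacobian F (at x) *v (x - z))"
proof (rule ccontr)
  assume neg: "\<not> ?thesis"
  let ?F = "\<lambda>u. real_of_ereal (f u)" and ?J = "\<lambda>v. jacobian F (at x) *v v"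
  define p where "p = l *\<^sub>R (egrad f z - egrad f x)"
  have zdom: "z \<in> edom f" using z(1) interior_subset by blast
  have "continuous_on (dual_generator C) (\<lambda>e. e \<bullet> ?J (x - z - h))" by (intro continuous_intros)
  then obtain c where c: "c \<in> dual_generator C"
    "\<And>e. e \<in> dual_generator C \<Longrightarrow> c \<bullet> ?J (x - z - h) \<le> e \<bullet> ?J (x - z - h)"
    using continuous_attains_inf[OF compact_dual_generator dual_generator_nonempty[OF C]] by blast
  have "continuous_on (dual_generator C) (\<lambda>e. e \<bullet> ?J (x - z))" by (intro continuous_intros)
  then obtain c0 where c0: "c0 \<in> dual_generator C"
    "\<And>e. e \<in> dual_generator C \<Longrightarrow> c0 \<bullet> ?J (x - z) \<le> e \<bullet> ?J (x - z)"
    using continuous_attains_inf[OF compact_dual_generator dual_generator_nonempty[OF C]] by blast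
  \<comment> \<open>\<open>m\<close> is the change of the minimum over the weights from
    \<open>z\<close> to \<open>z + h\<close>. As both minima are attained, the negated claim becomes
    the strict inequality \<open>p \<bullet> h < m\<close>.\<close>
  define m where "m = c \<bullet> ?J (x - z - h) - c0 \<bullet> ?J (x - z)"
  have "c0 \<bullet> ?J (x - z) + p \<bullet> h < c \<bullet> ?J (x - z - h)"
    using neg c(1) c0(2)[OF d] by (force simp: p_def)
  then have m: "p \<bullet> h < m" by (simp add: m_def)
  obtain \<epsilon> where \<epsilon>: "0 < \<epsilon>" "\<And>t. \<lbrakk>0 < t; t < \<epsilon>\<rbrakk> \<Longrightarrow> z + t *\<^sub>R h \<in> edom f"
    using interior_add_scaleR[OF z(1)] by blast
  have "m / l + egrad f x \<bullet> h \<le> egrad f z \<bullet> h"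
  proof (rule GDERIV_directional_ge[OF ediff_at_egrad[OF z(2)]])
    show "0 < min \<epsilon> 1" using \<epsilon>(1) by simp
    fix t :: real assume t: "0 < t" "t < min \<epsilon> 1"
    define y where "y = z + t *\<^sub>R h"
    have ydom: "y \<in> edom f" using \<epsilon>(2) t by (simp add: y_def)
    obtain e where e: "e \<in> dual_generator C"
      "gap_obj C F f l x y = ereal (e \<bullet> ?J (x - y)) - ereal l * bregman f y x"
      using gap_obj_attained[OF C] by blast
    have "gap_obj C F f l x y \<le> ereal (c0 \<bullet> ?J (x - z)) - ereal l * bregman f z x"
      using max[OF ydom] gap_obj_le[OF c0(1)] by (rule order_trans)
    then have le: "e \<bullet> ?J (x - y) - l * (?F y - ?F x - egrad f x \<bullet> (y - x))
        \<le> c0 \<bullet> ?J (x - z) - l * (?F z - ?F x - egrad f x \<bullet> (z - x))"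
      unfolding e(2) bregman_eq_ereal[OF f ydom x] bregman_eq_ereal[OF f zdom x] by simp
    have "x - y = (1 - t) *\<^sub>R (x - z) + t *\<^sub>R (x - z - h)"
      by (simp add: y_def algebra_simps)
    then have "e \<bullet> ?J (x - y) = (1 - t) * (e \<bullet> ?J (x - z)) + t * (e \<bullet> ?J (x - z - h))"
      by (simp only: matrix_vector_right_distrib matrix_vector_mult_scaleR inner_add_right inner_scaleR_right)
    \<comment> \<open>Concavity of the minimum: the value of each weight is affine along the segment
      and at least the minimum at either end.\<close>
    also have "\<dots> \<ge> (1 - t) * (c0 \<bullet> ?J (x - z)) + t * (c \<bullet> ?J (x - z - h))"
      using t c(2)[OF e(1)] c0(2)[OF e(1)] by (intro add_mono mult_left_mono) auto
    finally have "c0 \<bullet> ?J (x - z) + t * m \<le> e \<bullet> ?J (x - y)"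
      by (simp add: m_def algebra_simps)
    moreover have "egrad f x \<bullet> (y - x) = egrad f x \<bullet> (z - x) + t * (egrad f x \<bullet> h)"
      by (simp add: y_def inner_add_right inner_diff_right)
    ultimately have "t * m \<le> l * (?F y - ?F z - t * (egrad f x \<bullet> h))"
      using le by (simp add: algebra_simps)
    then have "t * m / l \<le> ?F y - ?F z - t * (egrad f x \<bullet> h)"
      using l by (simp add: divide_le_eq mult.commute)
    then show "?F z + t * (m / l + egrad f x \<bullet> h) \<le> ?F (z + t *\<^sub>R h)"
      by (simp add: y_def algebra_simps)
  qed
  then have "m / l \<le> (egrad f z - egrad f x) \<bullet> h" by (simp add: inner_diff_left)
  then have "m \<le> p \<bullet> h" using l by (simp add: p_def divide_le_eq mult.commute)
  with m show False by simp
qed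

text \<open>Optimality provides for each direction \<open>h\<close> some weight whose linearized
  objective does not increase; separation exchanges the quantifiers. In the resulting pair
  \<open>(0, r)\<close>, the zero is stationarity and \<open>r \<le> 0\<close> is minimality of the
  weight at \<open>z\<close>.\<close>

lemma gap_obj_saddle_point:
  fixes f :: "real^'n \<Rightarrow> ereal"
  assumes C: "closed C" "convex C" "cone C" "pointed C"
    and f: "proper f" and x: "x \<in> edom f" and l: "0 < l"
    and z: "z \<in> interior (edom f)" "ediff_at f z"
    and max: "\<And>y. y \<in> edom f \<Longrightarrow> gap_obj C F f l x y \<le> gap_obj C F f l x z"
  obtains d where "d \<in> dual_generator C"
    "\<And>e. e \<in> dual_generator C \<Longrightarrow>
      d \<bullet> (jacobian F (at x) *v (x - z)) \<le> e \<bullet> (jacobian F (at x) *v (x - z))"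
    "egrad f z = egrad f x - (1 / l) *\<^sub>R (transpose (jacobian F (at x)) *v d)"
proof -
  let ?J = "\<lambda>v. jacobian F (at x) *v v"
  define p where "p = l *\<^sub>R (egrad f z - egrad f x)"
  have "continuous_on (dual_generator C) (\<lambda>e. e \<bullet> ?J (x - z))" by (intro continuous_intros)
  then obtain c0 where c0: "c0 \<in> dual_generator C"
    "\<And>e. e \<in> dual_generator C \<Longrightarrow> c0 \<bullet> ?J (x - z) \<le> e \<bullet> ?J (x - z)"
    using continuous_attains_inf[OF compact_dual_generator dual_generator_nonempty[OF C]] by blast
  define T where "T = (\<lambda>e. (- (transpose (jacobian F (at x)) *v e), e \<bullet> ?J (x - z)))"
  \<comment> \<open>A pair in \<open>K\<close> holds the slope in \<open>h\<close> and the value at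
    \<open>h = 0\<close> of the linearized objective of one weight, measured against the least value
    at \<open>z\<close>.\<close>
  define K where "K = (\<lambda>v. (- p, - (c0 \<bullet> ?J (x - z))) + v) ` T ` dual_generator C"
  have "linear T"
    by (rule linearI)
      (simp_all add: T_def matrix_vector_right_distrib matrix_vector_mult_scaleR inner_add_left
        del: transpose_matrix_vector)
  moreover have "convex (dual_generator C)"
    unfolding dual_generator_def by (rule convex_convex_hull)
  ultimately have "compact K" "convex K"
    unfolding K_def
    by (auto intro!: compact_translation compact_continuous_image linear_continuous_on
        convex_translation convex_linear_image compact_dual_generator
        simp: linear_conv_bounded_linear[symmetric])
  moreover have "K \<noteq> {}" using c0(1) by (auto simp: K_def)
  moreover have "\<exists>(q, r)\<in>K. q \<bullet> h + r \<le> 0" for h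
  proof -
    obtain e where e: "e \<in> dual_generator C" "e \<bullet> ?J (x - z - h)
        - l * ((egrad f z - egrad f x) \<bullet> h) \<le> c0 \<bullet> ?J (x - z)"
      using gap_obj_maximizer_direction[OF C f x l z max c0(1)] by blast
    have "e \<bullet> ?J (x - z - h) = e \<bullet> ?J (x - z) - (transpose (jacobian F (at x)) *v e) \<bullet> h"
      by (simp add: matrix_vector_mult_diff_distrib inner_diff_right inner_matrix_vector_mult
          del: transpose_matrix_vector)
    then have "(- p + fst (T e)) \<bullet> h + (- (c0 \<bullet> ?J (x - z)) + snd (T e)) \<le> 0"
      using e(2) by (simp add: T_def p_def inner_diff_left inner_add_left del: transpose_matrix_vector)
    moreover have "(- p + fst (T e), - (c0 \<bullet> ?J (x - z)) + snd (T e)) \<in> K"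
      using e(1) by (auto simp: K_def image_iff intro!: bexI[of _ e] prod_eqI)
    ultimately show ?thesis by blast
  qed
  ultimately obtain r where "(0, r) \<in> K" "r \<le> 0"
    by (rule compact_convex_nonpos_at_zero)
  then obtain d where d: "d \<in> dual_generator C"
    "transpose (jacobian F (at x)) *v d = - p" "d \<bullet> ?J (x - z) \<le> c0 \<bullet> ?J (x - z)"
    by (auto simp: K_def T_def simp del: transpose_matrix_vector)
  show thesis
  proof (rule that[OF d(1)])
    show "d \<bullet> ?J (x - z) \<le> e \<bullet> ?J (x - z)" if "e \<in> dual_generator C" for e
      using d(3) c0(2)[OF that] by linarith
    show "egrad f z = egrad f x - (1 / l) *\<^sub>R (transpose (jacobian F (at x)) *v d)"
      using l unfolding d(2) by (simp add: p_def)
  qed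
qed

section \<open>Comparison of the gaps for two regularization parameters\<close>

theorem proposition5:
  fixes C :: "(real^'m) set"
    and \<Omega> :: "(real^'n) set"
    and F :: "real^'n \<Rightarrow> real^'m"
    and \<omega> :: "real^'n \<Rightarrow> ereal"
    and \<theta> :: "real \<Rightarrow> real"
    and x :: "real^'n"
    and l1 l2 :: real
  assumes "closed C" and "convex C" and "cone C" and "pointed C" and "interior C \<noteq> {}"
    and "closed \<Omega>" and "convex \<Omega>" and "interior \<Omega> \<noteq> {}"
    and "\<And>u. F differentiable (at u)"
    and "legendre \<omega>" and "closure (edom \<omega>) = \<Omega>"
    and standing: "\<And>l u. \<lbrakk>0 < l; u \<in> interior \<Omega>\<rbrakk> \<Longrightarrow>
          (\<exists>!y. is_arg_max (gap_obj C F \<omega> l u) (\<lambda>y. y \<in> \<Omega>) y) \<and>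
          gap_maximizer C \<Omega> F \<omega> l u \<in> interior \<Omega>"
    and theta_pos: "\<And>t. 0 < t \<Longrightarrow> 0 < \<theta> t"
    and theta_defined: "\<And>s c u. \<lbrakk>0 < s; c \<in> dual_generator C; u \<in> interior \<Omega>\<rbrakk> \<Longrightarrow>
          egrad \<omega> u - s *\<^sub>R (transpose (jacobian F (at u)) *v c) \<in> interior (edom (conjugate \<omega>))"
    and theta_ineq: "\<And>s1 s2 c u. \<lbrakk>0 < s1; 0 < s2; c \<in> dual_generator C; u \<in> interior \<Omega>\<rbrakk> \<Longrightarrow>
          bregman \<omega> u (egrad (conjugate \<omega>)
              (egrad \<omega> u - s1 *\<^sub>R (transpose (jacobian F (at u)) *v c)))
            \<ge> ereal (\<theta> (s1 / s2)) *
              bregman \<omega> u (egrad (conjugate \<omega>)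
                (egrad \<omega> u - s2 *\<^sub>R (transpose (jacobian F (at u)) *v c)))"
    and "x \<in> interior \<Omega>" and "l1 \<ge> l2" and "l2 > 0"
  shows "gap C \<Omega> F \<omega> l1 x \<le> gap C \<Omega> F \<omega> l2 x \<and>
         gap C \<Omega> F \<omega> l2 x \<le> ereal (l2 / (\<theta> (l2 / l1) * l1)) * gap C \<Omega> F \<omega> l1 x"
proof
  have \<omega>: "proper \<omega>" "convex (eepigraph \<omega>)" "essentially_smooth \<omega>"
    using \<open>legendre \<omega>\<close> by (auto simp: legendre_def closed_convex_fun_def)
  have int_eq: "interior (edom \<omega>) = interior \<Omega>"
    using convex_interior_closure[OF convex_edom[OF \<omega>(1,2)]] \<open>closure (edom \<omega>) = \<Omega>\<close> by simp
  have dom_sub: "edom \<omega> \<subseteq> \<Omega>" using \<open>closure (edom \<omega>) = \<Omega>\<close> closure_subset by blast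
  have dom: "u \<in> edom \<omega>" if "u \<in> interior \<Omega>" for u
    using that int_eq interior_subset by blast
  have diff: "ediff_at \<omega> u" if "u \<in> interior \<Omega>" for u
    using that \<omega>(3) int_eq by (simp add: essentially_smooth_def)
  have sub: "subgradient \<omega> (egrad \<omega> u) u" if "u \<in> interior \<Omega>" for u
    using subgradient_egrad[OF \<omega>(1,2) dom diff] that by blast
  have l1: "0 < l1" using \<open>l1 \<ge> l2\<close> \<open>l2 > 0\<close> by simp
  let ?z = "\<lambda>l d. egrad \<omega> x - (1 / l) *\<^sub>R (transpose (jacobian F (at x)) *v d)"

  \<comment> \<open>The Bregman distance is nonnegative, so a larger parameter lowers the objective
    at every point and for every weight.\<close>
  have "gap_obj C F \<omega> l1 x y \<le> gap_obj C F \<omega> l2 x y" for y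
    unfolding gap_obj_def
  proof (intro INF_superset_mono order_refl ereal_minus_mono)
    show "ereal l2 * bregman \<omega> y x \<le> ereal l1 * bregman \<omega> y x"
      using bregman_nonneg[OF \<omega>(1) sub[OF \<open>x \<in> interior \<Omega>\<close>]] \<open>l1 \<ge> l2\<close>
      by (intro ereal_mult_right_mono) auto
  qed
  then show "gap C \<Omega> F \<omega> l1 x \<le> gap C \<Omega> F \<omega> l2 x"
    unfolding gap_def by (intro SUP_mono) blast

  define y1 where "y1 = gap_maximizer C \<Omega> F \<omega> l1 x"
  \<comment> \<open>\<open>gap_maximizer\<close> is a choice among the maximizers, so its maximality
    follows from existence.\<close>
  have y1: "y1 \<in> interior \<Omega>" "is_arg_max (gap_obj C F \<omega> l1 x) (\<lambda>y. y \<in> \<Omega>) y1"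
    using standing[OF l1 \<open>x \<in> interior \<Omega>\<close>]
    unfolding y1_def gap_maximizer_def arg_max_on_def arg_max_def by (auto intro: someI)
  then have max: "gap_obj C F \<omega> l1 x y \<le> gap_obj C F \<omega> l1 x y1" if "y \<in> edom \<omega>" for y
    using that dom_sub by (auto simp: is_arg_max_linorder)
  obtain d where d: "d \<in> dual_generator C"
    and least: "\<And>e. e \<in> dual_generator C \<Longrightarrow>
      d \<bullet> (jacobian F (at x) *v (x - y1)) \<le> e \<bullet> (jacobian F (at x) *v (x - y1))"
    and egrad_y1: "egrad \<omega> y1 = ?z l1 d"
    using gap_obj_saddle_point[OF \<open>closed C\<close> \<open>convex C\<close> \<open>cone C\<close> \<open>pointed C\<close> \<omega>(1)
        dom[OF \<open>x \<in> interior \<Omega>\<close>] l1 _ diff[OF y1(1)] max] y1(1) int_eq by blast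
  have z_dom: "?z l d \<in> interior (edom (conjugate \<omega>))" if "0 < l" for l
    using theta_defined[of "1 / l" d x] that d \<open>x \<in> interior \<Omega>\<close> by simp
  have ne: "interior (edom \<omega>) \<noteq> {}" using \<open>x \<in> interior \<Omega>\<close> int_eq by blast
  note conj = legendre_egrad_conjugate[OF \<open>legendre \<omega>\<close> ne z_dom]
  define y2 where "y2 = egrad (conjugate \<omega>) (?z l2 d)"
  \<comment> \<open>The gradient equation and the inversion of gradients identify \<open>y1\<close>
    as the point in the hypothesis on \<open>\<theta>\<close> with step
    \<open>1 / l1\<close>.\<close>
  have y1_conj: "egrad (conjugate \<omega>) (?z l1 d) = y1"
    using conj(3)[OF l1] y1(1) egrad_y1 int_eq by blast
  have y2: "y2 \<in> interior \<Omega>" "egrad \<omega> y2 = ?z l2 d"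
    using conj(1,2)[OF \<open>l2 > 0\<close>] int_eq unfolding y2_def by blast+

  have lower: "ereal l1 * bregman \<omega> x y1 \<le> gap C \<Omega> F \<omega> l1 x"
    unfolding gap_def
    using bregman_le_gap_obj[OF \<omega>(1) dom[OF \<open>x \<in> interior \<Omega>\<close>] dom[OF y1(1)] l1 least egrad_y1]
      y1(1) interior_subset by (intro SUP_upper2[of y1]) auto
  have upper: "gap C \<Omega> F \<omega> l2 x \<le> ereal l2 * bregman \<omega> x y2"
    by (rule gap_le_bregman[OF \<omega>(1) dom[OF \<open>x \<in> interior \<Omega>\<close>] sub[OF y2(1)] d \<open>l2 > 0\<close> y2(2)])
  \<comment> \<open>The steps \<open>1 / l1\<close> and \<open>1 / l2\<close> have quotient
    \<open>l2 / l1\<close>.\<close>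
  have \<theta>: "ereal (\<theta> (l2 / l1)) * bregman \<omega> x y2 \<le> bregman \<omega> x y1"
    using theta_ineq[of "1 / l1" "1 / l2" d x] l1 \<open>l2 > 0\<close> d \<open>x \<in> interior \<Omega>\<close>
    unfolding y1_conj y2_def by simp
  have pos: "0 < \<theta> (l2 / l1)" using theta_pos l1 \<open>l2 > 0\<close> by simp
  \<comment> \<open>Both distances are finite because \<open>x\<close> lies in the effective domain,
    so dividing by \<open>\<theta> (l2 / l1)\<close> takes place in the reals.\<close>
  obtain b1 b2 where b: "bregman \<omega> x y1 = ereal b1" "bregman \<omega> x y2 = ereal b2"
    using bregman_eq_ereal[OF \<omega>(1) dom[OF \<open>x \<in> interior \<Omega>\<close>]] dom y1(1) y2(1) by blast
  have "l2 * b2 \<le> l2 / (\<theta> (l2 / l1) * l1) * (l1 * b1)"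
    using \<theta> pos l1 \<open>l2 > 0\<close> by (simp add: b field_simps)
  then have "ereal l2 * bregman \<omega> x y2 \<le> ereal (l2 / (\<theta> (l2 / l1) * l1)) * (ereal l1 * bregman \<omega> x y1)"
    by (simp add: b)
  also have "\<dots> \<le> ereal (l2 / (\<theta> (l2 / l1) * l1)) * gap C \<Omega> F \<omega> l1 x"
    using lower pos l1 \<open>l2 > 0\<close> by (intro ereal_mult_left_mono) auto
  finally show "gap C \<Omega> F \<omega> l2 x \<le> ereal (l2 / (\<theta> (l2 / l1) * l1)) * gap C \<Omega> F \<omega> l1 x"
    using upper order_trans by blast
qed

end
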